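(* Let $G$ be a finite simple graph of order $n$, where $n \ge 3$, and let $\overline{G}$ denote its complement. Then $$5\leq \gamma_{{\rm ri}2}(G)+\gamma_{{\rm ri}2}(\overline{G})\leq n+3,$$ and both bounds are sharp, that is, there is a graph of order at least $3$ for which the lower bound is attained with equality, and there is a graph of order $n\ge 3$ (for some $n$) for which the upper bound $n+3$ is attained with equality.
   Context: All graphs are finite and simple. A $2$-rainbow independent dominating function of a graph $G$ is a function $f\colon V(G)\to\{0,1,2\}$ such that, with $V_i=\{x\in V(G): f(x)=i\}$, (1) $V_1$ and $V_2$ are independent sets in $G$, and (2) every $x\in V_0$ has at least one neighbor in $V_1$ and at least one neighbor in $V_2$. Its weight is $|V_1|+|V_2|$. The $2$-rainbow independent domination number $\gamma_{{\rm ri}2}(G)$ is the minimum weight of a $2$-rainbow independent dominating function of $G$. *)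

theory Defs
  imports "Graph_Theory.Graph_Theory" "HOL-Library.FuncSet"
begin

text \<open>
  A finite simple graph is a \<^locale>\<open>pair_graph\<close>: a finite, loop-free, symmetric set of pairs
  of vertices, so an undirected edge between \<open>u\<close> and \<open>v\<close> is represented by both arcs
  \<open>(u, v)\<close> and \<open>(v, u)\<close>.
\<close>

definition graph_complement :: "'a pair_pre_digraph \<Rightarrow> 'a pair_pre_digraph" where
  "graph_complement G =
     \<lparr> pverts = pverts G,
       parcs = {(u, v). u \<in> pverts G \<and> v \<in> pverts G \<and> u \<noteq> v \<and> (u, v) \<notin> parcs G} \<rparr>"

definition independent_in :: "'a pair_pre_digraph \<Rightarrow> 'a set \<Rightarrow> bool" where
  "independent_in G S \<longleftrightarrow> S \<subseteq> pverts G \<and> (\<forall>u\<in>S. \<forall>v\<in>S. (u, v) \<notin> parcs G)"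

definition colour_class :: "'a pair_pre_digraph \<Rightarrow> ('a \<Rightarrow> nat) \<Rightarrow> nat \<Rightarrow> 'a set" where
  "colour_class G f i = {x \<in> pverts G. f x = i}"

definition two_rainbow_indep_dom :: "'a pair_pre_digraph \<Rightarrow> ('a \<Rightarrow> nat) \<Rightarrow> bool" where
  "two_rainbow_indep_dom G f \<longleftrightarrow>
     f \<in> pverts G \<rightarrow> {0, 1, 2} \<and>
     independent_in G (colour_class G f 1) \<and>
     independent_in G (colour_class G f 2) \<and>
     (\<forall>x \<in> colour_class G f 0.
        (\<exists>y \<in> colour_class G f 1. (x, y) \<in> parcs G) \<and>
        (\<exists>y \<in> colour_class G f 2. (x, y) \<in> parcs G))"

definition weight :: "'a pair_pre_digraph \<Rightarrow> ('a \<Rightarrow> nat) \<Rightarrow> nat" where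
  "weight G f = card (colour_class G f 1) + card (colour_class G f 2)"

text \<open>The minimum below is attained for every finite simple graph, see
  \<open>two_rainbow_indep_dom_exists\<close>.\<close>

definition gamma_ri2 :: "'a pair_pre_digraph \<Rightarrow> nat" where
  "gamma_ri2 G = (LEAST k. \<exists>f. two_rainbow_indep_dom G f \<and> weight G f = k)"

lemma pair_graph_complement:
  assumes "pair_graph G"
  shows "pair_graph (graph_complement G)"
proof -
  interpret pair_graph G by fact
  have fin: "finite {(u, v). u \<in> pverts G \<and> v \<in> pverts G \<and> u \<noteq> v \<and> (u, v) \<notin> parcs G}"
    by (rule finite_subset[of _ "pverts G \<times> pverts G"]) (auto simp: pair_finite_verts)
  have "sym (parcs G)"
    using pair_sym_arcs by (simp add: symmetric_def)
  then show ?thesis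
    using fin by unfold_locales
      (auto simp: graph_complement_def pair_finite_verts symmetric_def sym_def)
qed

lemma maximal_independent_exists:
  assumes "pair_graph G" "W \<subseteq> pverts G"
  obtains S where "S \<subseteq> W" "independent_in G S"
    "\<And>x. x \<in> W - S \<Longrightarrow> \<exists>y\<in>S. (x, y) \<in> parcs G"
proof -
  interpret pair_graph G by fact
  have sy: "sym (parcs G)"
    using pair_sym_arcs by (simp add: symmetric_def)
  let ?F = "{S. S \<subseteq> W \<and> independent_in G S}"
  have "finite W" using assms(2) pair_finite_verts finite_subset by blast
  then have fin: "finite ?F" by simp
  have "{} \<in> ?F" by (simp add: independent_in_def)
  then have ne: "?F \<noteq> {}" by (metis empty_iff)
  from finite_has_maximal[OF fin ne]
  obtain S where S: "S \<in> ?F" and mx: "\<forall>T\<in>?F. S \<subseteq> T \<longrightarrow> S = T" by (rule bexE)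
  have "\<exists>y\<in>S. (x, y) \<in> parcs G" if x: "x \<in> W - S" for x
  proof (rule ccontr)
    assume no: "\<not> ?thesis"
    have "(x, x) \<notin> parcs G" using pair_no_loops by force
    then have "insert x S \<in> ?F"
      using S x no sy assms(2) by (auto simp: independent_in_def sym_def)
    with mx have "S \<subseteq> insert x S \<longrightarrow> S = insert x S" by (rule bspec)
    with x show False by auto
  qed
  then show ?thesis using S by (intro that[of S]) simp_all
qed

lemma two_rainbow_indep_dom_exists:
  assumes "pair_graph G"
  shows "\<exists>f. two_rainbow_indep_dom G f"
proof -
  obtain A where A: "A \<subseteq> pverts G" "independent_in G A"
    "\<And>x. x \<in> pverts G - A \<Longrightarrow> \<exists>y\<in>A. (x, y) \<in> parcs G"
    using maximal_independent_exists[OF assms, of "pverts G"] by blast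
  obtain B where B: "B \<subseteq> pverts G - A" "independent_in G B"
    "\<And>x. x \<in> pverts G - A - B \<Longrightarrow> \<exists>y\<in>B. (x, y) \<in> parcs G"
    using maximal_independent_exists[OF assms, of "pverts G - A"] by blast
  define f :: "'a \<Rightarrow> nat" where "f x = (if x \<in> A then 1 else if x \<in> B then 2 else 0)" for x
  have "colour_class G f 1 = A" "colour_class G f 2 = B"
    "colour_class G f 0 = pverts G - A - B"
    using A(1) B(1) by (auto simp: colour_class_def f_def split: if_splits)
  moreover have "f \<in> pverts G \<rightarrow> {0, 1, 2}" by (auto simp: f_def)
  ultimately have "two_rainbow_indep_dom G f"
    using A B unfolding two_rainbow_indep_dom_def by auto
  then show ?thesis by (intro exI[of _ f])
qed

end

theory Submission
  imports Defs
begin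

text \<open>
  Write \<open>S\<close> and \<open>T\<close> for the sets of coloured vertices of a rainbow function of \<open>G\<close> and of its
  complement. The colour classes in \<open>G\<close> are independent, those in the complement are cliques of
  \<open>G\<close>, so a class of \<open>S\<close> meets a class of \<open>T\<close> in at most one vertex and \<open>|S \<inter> T| \<le> 4\<close>. Since
  \<open>|S| + |T| = |S \<union> T| + |S \<inter> T|\<close>, it suffices to save one vertex, and any vertex \<open>x\<close> does this.
  If \<open>x\<close> has degree at least 2 in both graphs, colouring two of its neighbours differently and
  extending greedily leaves \<open>x\<close> uncoloured; doing so in both graphs, \<open>S \<union> T\<close> misses \<open>x\<close>. If \<open>x\<close> has degree
  at most 1 in one of the graphs, then \<open>{x}\<close> can be made a colour class of the other one,
  so \<open>|S \<inter> T| \<le> 3\<close>.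

  For the lower bound, both numbers are at least 2. If \<open>G\<close> has a rainbow function of weight 2, its two
  coloured vertices are joined to all others, hence have degree at most 1 in the complement and are
  coloured by every rainbow function there; they dominate none of the others, so a third coloured
  vertex is needed. The path with three vertices and the 5-cycle, whose complement is again a
  5-cycle, attain the bounds.
\<close>

section \<open>Finite simple graphs and their complements\<close>

definition nbrs :: "'a pair_pre_digraph \<Rightarrow> 'a \<Rightarrow> 'a set" where
  "nbrs G x = {y. (x, y) \<in> parcs G}"

lemma pair_graph_sym:
  assumes "pair_graph G" "(x, y) \<in> parcs G"
  shows "(y, x) \<in> parcs G"
proof -
  interpret pair_graph G by fact
  show ?thesis using pair_sym_arcs assms(2) by (auto simp: symmetric_def sym_def)
qed

lemma pair_graph_irrefl:
  assumes "pair_graph G"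
  shows "(x, x) \<notin> parcs G"
proof -
  interpret pair_graph G by fact
  show ?thesis using pair_no_loops by force
qed

lemma pair_graph_arc_in_verts:
  assumes "pair_graph G" "(x, y) \<in> parcs G"
  shows "x \<in> pverts G" "y \<in> pverts G"
proof -
  interpret pair_graph G by fact
  show "x \<in> pverts G" "y \<in> pverts G"
    using assms(2) in_arcsD1 in_arcsD2 by auto
qed

lemma pair_graph_finite_verts: "pair_graph G \<Longrightarrow> finite (pverts G)"
proof -
  assume "pair_graph G"
  then interpret pair_graph G .
  show ?thesis by (rule pair_finite_verts)
qed

lemma pair_graphI:
  assumes "finite (pverts G)" "parcs G \<subseteq> pverts G \<times> pverts G" "sym (parcs G)" "irrefl (parcs G)"
  shows "pair_graph G"
proof -
  have "finite (parcs G)"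
    using assms(1,2) finite_subset by blast
  then show ?thesis
    using assms by unfold_locales (auto simp: symmetric_def irrefl_def)
qed

lemma pverts_complement [simp]: "pverts (graph_complement G) = pverts G"
  by (simp add: graph_complement_def)

lemma parcs_complement:
  "(x, y) \<in> parcs (graph_complement G) \<longleftrightarrow>
     x \<in> pverts G \<and> y \<in> pverts G \<and> x \<noteq> y \<and> (x, y) \<notin> parcs G"
  by (simp add: graph_complement_def)

lemma complement_complement:
  assumes "pair_graph G"
  shows "graph_complement (graph_complement G) = G"
  using pair_graph_arc_in_verts[OF assms] pair_graph_irrefl[OF assms]
  by (intro pair_pre_digraph.equality) (auto simp: graph_complement_def)

section \<open>Coloured vertices, weight and its minimum\<close>

definition coloured :: "'a pair_pre_digraph \<Rightarrow> ('a \<Rightarrow> nat) \<Rightarrow> 'a set" where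
  "coloured G f = colour_class G f 1 \<union> colour_class G f 2"

lemma colour_class_subset: "colour_class G f i \<subseteq> pverts G"
  by (auto simp: colour_class_def)

lemma coloured_subset: "coloured G f \<subseteq> pverts G"
  by (auto simp: coloured_def colour_class_def)

lemma finite_colour_class: "pair_graph G \<Longrightarrow> finite (colour_class G f i)"
  using colour_class_subset pair_graph_finite_verts finite_subset by metis

lemma weight_eq_card_coloured:
  assumes "pair_graph G"
  shows "weight G f = card (coloured G f)"
  unfolding weight_def coloured_def
  by (rule card_Un_disjoint[symmetric])
    (auto simp: finite_colour_class[OF assms] simp del: One_nat_def, auto simp: colour_class_def)

lemma uncoloured:
  assumes "two_rainbow_indep_dom G f" "x \<in> pverts G" "x \<notin> coloured G f"
  obtains y z where "y \<in> colour_class G f 1" "(x, y) \<in> parcs G"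
    "z \<in> colour_class G f 2" "(x, z) \<in> parcs G"
proof -
  have "f x \<in> {0, 1, 2}"
    using assms unfolding two_rainbow_indep_dom_def by blast
  then have "x \<in> colour_class G f 0"
    using assms(2,3) by (auto simp: coloured_def colour_class_def)
  then show ?thesis
    using assms(1) that unfolding two_rainbow_indep_dom_def by blast
qed

lemma gamma_ri2_le: "two_rainbow_indep_dom G f \<Longrightarrow> gamma_ri2 G \<le> weight G f"
  unfolding gamma_ri2_def by (rule Least_le) blast

lemma gamma_ri2_attained:
  assumes "pair_graph G"
  obtains f where "two_rainbow_indep_dom G f" "weight G f = gamma_ri2 G"
proof -
  have "\<exists>f. two_rainbow_indep_dom G f \<and> weight G f = gamma_ri2 G"
    unfolding gamma_ri2_def
    by (rule LeastI_ex) (use two_rainbow_indep_dom_exists[OF assms] in blast)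
  then show ?thesis using that by blast
qed

lemma gamma_ri2_ge:
  assumes "pair_graph G" "\<And>f. two_rainbow_indep_dom G f \<Longrightarrow> k \<le> weight G f"
  shows "k \<le> gamma_ri2 G"
  using assms by (metis gamma_ri2_attained)

section \<open>Greedy extension of partial colourings\<close>

text \<open>Let \<open>S\<close> be maximal among the independent sets of vertices of
  \<open>W\<close> without a neighbour in \<open>Y\<close>. A vertex of \<open>Y\<close> outside
  \<open>S\<close> would need a neighbour in \<open>S\<close>, which is ruled out, so
  \<open>S\<close> absorbs \<open>Y\<close>; the vertices of \<open>W\<close> dropped beforehand are
  dominated by \<open>Y\<close>.\<close>

lemma maximal_independent_extension:
  assumes G: "pair_graph G" and "W \<subseteq> pverts G" "Y \<subseteq> W" "independent_in G Y"
  obtains S where "Y \<subseteq> S" "S \<subseteq> W" "independent_in G S"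
    "\<And>x. x \<in> W - S \<Longrightarrow> \<exists>y\<in>S. (x, y) \<in> parcs G"
proof -
  define W' where "W' = {x \<in> W. \<forall>y\<in>Y. (x, y) \<notin> parcs G}"
  have "W' \<subseteq> pverts G" using assms(2) by (auto simp: W'_def)
  then obtain S where S: "S \<subseteq> W'" "independent_in G S"
    "\<And>x. x \<in> W' - S \<Longrightarrow> \<exists>y\<in>S. (x, y) \<in> parcs G"
    using maximal_independent_exists[OF G] by blast
  have "Y \<subseteq> W'"
    using assms(3,4) by (auto simp: W'_def independent_in_def)
  have "Y \<subseteq> S"
  proof
    fix y assume "y \<in> Y"
    show "y \<in> S"
    proof (rule ccontr)
      assume "y \<notin> S"
      with S(3) \<open>y \<in> Y\<close> \<open>Y \<subseteq> W'\<close> obtain z where "z \<in> S" "(y, z) \<in> parcs G" by blast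
      then show False
        using S(1) \<open>y \<in> Y\<close> pair_graph_sym[OF G] by (auto simp: W'_def)
    qed
  qed
  moreover have "\<exists>y\<in>S. (x, y) \<in> parcs G" if "x \<in> W - S" for x
    using that S(3) \<open>Y \<subseteq> S\<close> by (cases "x \<in> W'") (auto simp: W'_def)
  moreover have "S \<subseteq> W" using S(1) by (auto simp: W'_def)
  ultimately show ?thesis using S(2) that by simp
qed

text \<open>Class 1 extends \<open>Y\<close> maximally outside \<open>Z\<close>, then class 2
  extends \<open>Z\<close> maximally outside class 1. A vertex in neither class is outside
  \<open>Z\<close> too, so both maximalities apply and give it a neighbour of each colour.\<close>

lemma rainbow_extension:
  assumes G: "pair_graph G" and "independent_in G Y" "independent_in G Z" "Y \<inter> Z = {}"
  obtains f where "two_rainbow_indep_dom G f" "Y \<subseteq> colour_class G f 1" "Z \<subseteq> colour_class G f 2"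
proof -
  have YZ: "Y \<subseteq> pverts G" "Z \<subseteq> pverts G"
    using assms by (auto simp: independent_in_def)
  obtain A where A: "Y \<subseteq> A" "A \<subseteq> pverts G - Z" "independent_in G A"
    "\<And>x. x \<in> pverts G - Z - A \<Longrightarrow> \<exists>y\<in>A. (x, y) \<in> parcs G"
  proof (rule maximal_independent_extension[OF G])
    show "Y \<subseteq> pverts G - Z" using YZ assms(4) by blast
  qed (use assms(2) in auto)
  obtain B where B: "Z \<subseteq> B" "B \<subseteq> pverts G - A" "independent_in G B"
    "\<And>x. x \<in> pverts G - A - B \<Longrightarrow> \<exists>y\<in>B. (x, y) \<in> parcs G"
  proof (rule maximal_independent_extension[OF G])
    show "Z \<subseteq> pverts G - A" using YZ A(2) by blast
  qed (use assms(3) in auto)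
  define f :: "'a \<Rightarrow> nat" where "f x = (if x \<in> A then 1 else if x \<in> B then 2 else 0)" for x
  have c: "colour_class G f 1 = A" "colour_class G f 2 = B"
    "colour_class G f 0 = pverts G - A - B"
    using A(2) B(2) by (auto simp: colour_class_def f_def split: if_splits)
  moreover have "f \<in> pverts G \<rightarrow> {0, 1, 2}" by (auto simp: f_def)
  ultimately have "two_rainbow_indep_dom G f"
    using A B unfolding two_rainbow_indep_dom_def by blast
  then show ?thesis using that c A(1) B(1) by simp
qed

text \<open>Neighbours \<open>y\<close> and \<open>z\<close> of different colours rule out both
  colours at \<open>x\<close>.\<close>

lemma rainbow_avoiding:
  assumes G: "pair_graph G" and "y \<in> nbrs G x" "z \<in> nbrs G x" "y \<noteq> z"
  obtains f where "two_rainbow_indep_dom G f" "x \<notin> coloured G f"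
proof -
  have arcs: "(x, y) \<in> parcs G" "(x, z) \<in> parcs G"
    using assms by (auto simp: nbrs_def)
  then have "independent_in G {y}" "independent_in G {z}"
    using pair_graph_arc_in_verts[OF G] pair_graph_irrefl[OF G]
    by (auto simp: independent_in_def)
  then obtain f where f: "two_rainbow_indep_dom G f"
    "y \<in> colour_class G f 1" "z \<in> colour_class G f 2"
    using rainbow_extension[OF G, of "{y}" "{z}"] \<open>y \<noteq> z\<close> by auto
  then have "x \<notin> coloured G f"
    using arcs unfolding two_rainbow_indep_dom_def independent_in_def coloured_def by blast
  with f(1) show ?thesis by (rule that)
qed

text \<open>In the complement, \<open>x\<close> is joined to everything but its at most one
  neighbour in \<open>G\<close>. Once that neighbour is given colour 2, no other vertex can share
  colour 1 with \<open>x\<close>.\<close>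

lemma rainbow_complement_singleton:
  assumes G: "pair_graph G" and x: "x \<in> pverts G"
    and deg: "\<And>y z. y \<in> nbrs G x \<Longrightarrow> z \<in> nbrs G x \<Longrightarrow> y = z"
  obtains f where "two_rainbow_indep_dom (graph_complement G) f"
    "colour_class (graph_complement G) f 1 = {x}"
proof -
  let ?H = "graph_complement G"
  note H = pair_graph_complement[OF G]
  have "independent_in ?H {x}" "independent_in ?H (nbrs G x)" "{x} \<inter> nbrs G x = {}"
    using x deg pair_graph_arc_in_verts[OF G] pair_graph_irrefl[OF G]
    by (auto simp: independent_in_def parcs_complement nbrs_def)
  then obtain f where f: "two_rainbow_indep_dom ?H f"
    "{x} \<subseteq> colour_class ?H f 1" "nbrs G x \<subseteq> colour_class ?H f 2"
    using rainbow_extension[OF H] by blast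
  have "y = x" if "y \<in> colour_class ?H f 1" for y
  proof (rule ccontr)
    assume "y \<noteq> x"
    have "y \<notin> nbrs G x"
      using that f(3) by (auto simp: colour_class_def)
    moreover have "y \<in> pverts G"
      using that by (auto simp: colour_class_def)
    ultimately have "(x, y) \<in> parcs ?H"
      using x \<open>y \<noteq> x\<close> by (auto simp: parcs_complement nbrs_def)
    then show False
      using that f(1,2) unfolding two_rainbow_indep_dom_def independent_in_def by blast
  qed
  then have "colour_class ?H f 1 = {x}" using f(2) by blast
  with f(1) show ?thesis by (rule that)
qed

section \<open>Overlap of the two colourings and the upper bound\<close>

text \<open>Two distinct common vertices would be adjacent neither in \<open>G\<close> nor in its
  complement.\<close>

lemma card_independent_Int_complement_independent:
  assumes "independent_in G I" "independent_in (graph_complement G) K"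
  shows "card (I \<inter> K) \<le> 1"
proof -
  have "x = y" if "x \<in> I \<inter> K" "y \<in> I \<inter> K" for x y
    using that assms unfolding independent_in_def parcs_complement by blast
  \<comment> \<open>The infinite case is covered by \<open>card\<close> being 0 there.\<close>
  then show ?thesis
    by (metis One_nat_def card.empty card_le_Suc0_iff_eq card.infinite zero_le)
qed

lemma card_coloured_Int_le:
  assumes f: "two_rainbow_indep_dom G f" and K: "independent_in (graph_complement G) K"
  shows "card (coloured G f \<inter> K) \<le> 2"
proof -
  have "card (colour_class G f 1 \<inter> K) \<le> 1" "card (colour_class G f 2 \<inter> K) \<le> 1"
    using f K card_independent_Int_complement_independent
    unfolding two_rainbow_indep_dom_def by blast+
  then have "card (colour_class G f 1 \<inter> K \<union> colour_class G f 2 \<inter> K) \<le> 2"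
    using card_Un_le[of "colour_class G f 1 \<inter> K" "colour_class G f 2 \<inter> K"] by linarith
  then show ?thesis
    by (simp add: coloured_def Int_Un_distrib2)
qed

text \<open>Each class of \<open>g\<close> contributes at most 2, and the first one at most its own
  size. The minimum serves both uses: the bound is at most 4 always, and 3 when the first class is a
  singleton.\<close>

lemma card_coloured_Int_coloured_le:
  assumes G: "pair_graph G" and f: "two_rainbow_indep_dom G f" and g: "two_rainbow_indep_dom (graph_complement G) g"
  shows "card (coloured G f \<inter> coloured (graph_complement G) g) \<le>
    min 2 (card (colour_class (graph_complement G) g 1)) + 2"
proof -
  let ?S = "coloured G f" and ?A = "colour_class (graph_complement G) g 1"
    and ?B = "colour_class (graph_complement G) g 2"
  have "card (?S \<inter> ?A) \<le> 2" "card (?S \<inter> ?B) \<le> 2"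
    using g card_coloured_Int_le[OF f] unfolding two_rainbow_indep_dom_def by blast+
  moreover have "card (?S \<inter> ?A) \<le> card ?A"
    by (rule card_mono) (simp_all only: finite_colour_class[OF pair_graph_complement[OF G]] Int_lower2)
  ultimately have "card (?S \<inter> ?A \<union> ?S \<inter> ?B) \<le> min 2 (card ?A) + 2"
    using card_Un_le[of "?S \<inter> ?A" "?S \<inter> ?B"] by linarith
  then show ?thesis
    by (simp add: coloured_def Int_Un_distrib)
qed

lemma gamma_ri2_sum_le:
  assumes G: "pair_graph G"
    and f: "two_rainbow_indep_dom G f" and g: "two_rainbow_indep_dom (graph_complement G) g"
  shows "gamma_ri2 G + gamma_ri2 (graph_complement G) \<le>
    card (coloured G f \<union> coloured (graph_complement G) g) +
    card (coloured G f \<inter> coloured (graph_complement G) g)"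
proof -
  let ?H = "graph_complement G"
  have "gamma_ri2 G + gamma_ri2 ?H \<le> card (coloured G f) + card (coloured ?H g)"
    using gamma_ri2_le[OF f] gamma_ri2_le[OF g]
    by (simp add: weight_eq_card_coloured G pair_graph_complement add_mono)
  also have "\<dots> = card (coloured G f \<union> coloured ?H g) + card (coloured G f \<inter> coloured ?H g)"
    using coloured_subset[of G f] coloured_subset[of ?H g] pair_graph_finite_verts[OF G]
    by (intro card_Un_Int) (auto intro: finite_subset)
  finally show ?thesis .
qed

lemma gamma_ri2_sum_le_low_degree:
  assumes G: "pair_graph G" and x: "x \<in> pverts G"
    and deg: "\<And>y z. y \<in> nbrs G x \<Longrightarrow> z \<in> nbrs G x \<Longrightarrow> y = z"
  shows "gamma_ri2 G + gamma_ri2 (graph_complement G) \<le> card (pverts G) + 3"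
proof -
  let ?H = "graph_complement G"
  \<comment> \<open>Any rainbow function of \<open>G\<close> will do; the saving comes from
    \<open>g\<close> alone.\<close>
  obtain f where f: "two_rainbow_indep_dom G f"
    using two_rainbow_indep_dom_exists[OF G] by blast
  obtain g where g: "two_rainbow_indep_dom ?H g" "colour_class ?H g 1 = {x}"
    using rainbow_complement_singleton[OF G x deg] by blast
  have "card (coloured G f \<union> coloured ?H g) \<le> card (pverts G)"
    using coloured_subset[of G f] coloured_subset[of ?H g]
    by (intro card_mono pair_graph_finite_verts[OF G]) auto
  moreover have "card (coloured G f \<inter> coloured ?H g) \<le> 3"
    using card_coloured_Int_coloured_le[OF G f g(1)] unfolding g(2) by simp
  ultimately show ?thesis
    using gamma_ri2_sum_le[OF G f g(1)] by linarith
qed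

lemma gamma_ri2_sum_upper:
  assumes G: "pair_graph G" and ne: "pverts G \<noteq> {}"
  shows "gamma_ri2 G + gamma_ri2 (graph_complement G) \<le> card (pverts G) + 3"
proof -
  let ?H = "graph_complement G"
  note H = pair_graph_complement[OF G]
  obtain x where x: "x \<in> pverts G" using ne by blast
  consider (lowG) "\<And>y z. y \<in> nbrs G x \<Longrightarrow> z \<in> nbrs G x \<Longrightarrow> y = z"
    | (lowH) "\<And>y z. y \<in> nbrs ?H x \<Longrightarrow> z \<in> nbrs ?H x \<Longrightarrow> y = z"
    | (high) y z y' z' where "y \<in> nbrs G x" "z \<in> nbrs G x" "y \<noteq> z"
      "y' \<in> nbrs ?H x" "z' \<in> nbrs ?H x" "y' \<noteq> z'"
    by blast
  then show ?thesis
  proof cases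
    case lowG
    then show ?thesis by (rule gamma_ri2_sum_le_low_degree[OF G x])
  next
    case lowH
    \<comment> \<open>The roles of \<open>G\<close> and its complement are exchanged.\<close>
    then show ?thesis
      using gamma_ri2_sum_le_low_degree[OF H, of x] x
      by (simp add: complement_complement[OF G] add.commute)
  next
    case high
    obtain f where f: "two_rainbow_indep_dom G f" "x \<notin> coloured G f"
      using rainbow_avoiding[OF G high(1-3)] .
    obtain g where g: "two_rainbow_indep_dom ?H g" "x \<notin> coloured ?H g"
      using rainbow_avoiding[OF H high(4-6)] .
    have "coloured G f \<union> coloured ?H g \<subset> pverts G"
      using coloured_subset[of G f] coloured_subset[of ?H g] f(2) g(2) x by auto
    then have "card (coloured G f \<union> coloured ?H g) < card (pverts G)"
      by (rule psubset_card_mono[OF pair_graph_finite_verts[OF G]])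
    moreover have "card (coloured G f \<inter> coloured ?H g) \<le> 4"
      using card_coloured_Int_coloured_le[OF G f(1) g(1)] by linarith
    ultimately show ?thesis
      using gamma_ri2_sum_le[OF G f(1) g(1)] by linarith
  qed
qed

section \<open>The lower bound\<close>

lemma colour_classes_nonempty:
  assumes "two_rainbow_indep_dom G f" "coloured G f \<noteq> pverts G"
  shows "colour_class G f 1 \<noteq> {}" "colour_class G f 2 \<noteq> {}"
proof -
  obtain x where "x \<in> pverts G" "x \<notin> coloured G f"
    using assms(2) coloured_subset[of G f] by blast
  with uncoloured[OF assms(1)]
  show "colour_class G f 1 \<noteq> {}" "colour_class G f 2 \<noteq> {}" by blast+
qed

text \<open>Either every vertex is coloured, or an uncoloured one sees both colours.\<close>

lemma weight_ge_2:
  assumes G: "pair_graph G" and n: "card (pverts G) \<ge> 2" and f: "two_rainbow_indep_dom G f"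
  shows "weight G f \<ge> 2"
proof (cases "coloured G f = pverts G")
  case True
  then show ?thesis using n by (simp add: weight_eq_card_coloured[OF G])
next
  case False
  then have "card (colour_class G f 1) > 0" "card (colour_class G f 2) > 0"
    using colour_classes_nonempty[OF f False] finite_colour_class[OF G]
    by (auto simp: card_gt_0_iff simp del: One_nat_def)
  then show ?thesis by (simp add: weight_def)
qed

lemma weight_complement_ge_3:
  assumes G: "pair_graph G" and n: "card (pverts G) \<ge> 3"
    and f: "two_rainbow_indep_dom G f" "weight G f = 2"
    and g: "two_rainbow_indep_dom (graph_complement G) g"
  shows "weight (graph_complement G) g \<ge> 3"
proof -
  let ?H = "graph_complement G"
  note H = pair_graph_complement[OF G]
  \<comment> \<open>Weight 2 on at least three vertices leaves one uncoloured, so each colour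
    occurs, hence exactly once.\<close>
  have "coloured G f \<noteq> pverts G"
    using n f(2) by (auto simp: weight_eq_card_coloured[OF G])
  then have "card (colour_class G f 1) > 0" "card (colour_class G f 2) > 0"
    using colour_classes_nonempty[OF f(1)] finite_colour_class[OF G]
    by (auto simp: card_gt_0_iff simp del: One_nat_def)
  then have "card (colour_class G f 1) = 1" "card (colour_class G f 2) = 1"
    using f(2) unfolding weight_def by linarith+
  then obtain a b where ab: "colour_class G f 1 = {a}" "colour_class G f 2 = {b}"
    by (auto simp: card_1_singleton_iff)
  have cf: "coloured G f = {a, b}" by (auto simp: coloured_def ab simp del: One_nat_def)
  have abV: "a \<in> pverts G" "b \<in> pverts G"
    using coloured_subset[of G f] cf by auto
  have "a \<noteq> b"
    using f(2) cf by (auto simp: weight_eq_card_coloured[OF G])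
  have join: "(x, a) \<in> parcs G \<and> (x, b) \<in> parcs G" if "x \<in> pverts G" "x \<notin> {a, b}" for x
    using uncoloured[OF f(1), of x] that by (auto simp: cf ab simp del: One_nat_def)
  \<comment> \<open>All other vertices are joined to \<open>a\<close> and \<open>b\<close> in
    \<open>G\<close>, so the complement has no arc from \<open>{a, b}\<close> to the rest.\<close>
  have sep: "y \<in> {a, b}" if "(x, y) \<in> parcs ?H" "x \<in> {a, b}" for x y
    using that join[of y] pair_graph_sym[OF G] by (auto simp: parcs_complement)
  have "x \<in> coloured ?H g" if "x \<in> {a, b}" for x
  proof (rule ccontr)
    assume "x \<notin> coloured ?H g"
    moreover have "x \<in> pverts ?H" using that abV by auto
    ultimately obtain y z where yz: "y \<in> colour_class ?H g 1" "(x, y) \<in> parcs ?H"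
      "z \<in> colour_class ?H g 2" "(x, z) \<in> parcs ?H"
      using uncoloured[OF g] by blast
    then have "y \<in> {a, b} - {x}" "z \<in> {a, b} - {x}"
      using sep that by (auto simp: parcs_complement)
    \<comment> \<open>Removing \<open>x\<close> from \<open>{a, b}\<close> leaves a single vertex,
      which cannot carry both colours.\<close>
    then have "y = z" using that by auto
    then show False using yz by (auto simp: colour_class_def)
  qed
  then have sub: "{a, b} \<subseteq> coloured ?H g" by blast
  have "coloured ?H g \<noteq> {a, b}"
  proof
    assume eq: "coloured ?H g = {a, b}"
    have "\<not> pverts G \<subseteq> {a, b}"
    proof
      assume "pverts G \<subseteq> {a, b}"
      then have "card (pverts G) \<le> card {a, b}" by (intro card_mono) auto
      then show False using n \<open>a \<noteq> b\<close> by simp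
    qed
    \<comment> \<open>A third vertex would be uncoloured and need a neighbour in
      \<open>{a, b}\<close>, against \<open>sep\<close>.\<close>
    then obtain x where x: "x \<in> pverts G" "x \<notin> {a, b}" by blast
    then obtain y where "y \<in> colour_class ?H g 1" "(x, y) \<in> parcs ?H"
      using uncoloured[OF g, of x] eq by auto
    moreover from this have "y \<in> {a, b}" using eq by (auto simp: coloured_def)
    ultimately show False
      using sep[of y x] pair_graph_sym[OF H] x(2) by blast
  qed
  with sub have "{a, b} \<subset> coloured ?H g" by blast
  moreover have "finite (coloured ?H g)"
    using coloured_subset[of ?H g] pair_graph_finite_verts[OF H] finite_subset by blast
  ultimately have "card {a, b} < card (coloured ?H g)" by (rule psubset_card_mono[rotated])
  then show ?thesis
    using \<open>a \<noteq> b\<close> by (simp add: weight_eq_card_coloured[OF H])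
qed

lemma gamma_ri2_sum_lower:
  assumes G: "pair_graph G" and n: "card (pverts G) \<ge> 3"
  shows "5 \<le> gamma_ri2 G + gamma_ri2 (graph_complement G)"
proof -
  note H = pair_graph_complement[OF G]
  have ge2: "gamma_ri2 G \<ge> 2" "gamma_ri2 (graph_complement G) \<ge> 2"
    using n by (auto intro!: gamma_ri2_ge weight_ge_2 G H)
  obtain f where f: "two_rainbow_indep_dom G f" "weight G f = gamma_ri2 G"
    using gamma_ri2_attained[OF G] .
  show ?thesis
  \<comment> \<open>If the value is 2, the minimiser \<open>f\<close> forces 3 in the complement;
    otherwise 3 + 2 suffices.\<close>
  proof (cases "gamma_ri2 G = 2")
    case True
    then have "gamma_ri2 (graph_complement G) \<ge> 3"
      using f by (intro gamma_ri2_ge H weight_complement_ge_3[OF G n f(1)]) auto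
    with ge2 show ?thesis by linarith
  next
    case False
    with ge2 show ?thesis by linarith
  qed
qed

section \<open>Sharpness of the lower bound: the path with three vertices\<close>

lemma gamma_ri2_le_card:
  assumes "pair_graph G"
  shows "gamma_ri2 G \<le> card (pverts G)"
proof -
  obtain f where "two_rainbow_indep_dom G f" "weight G f = gamma_ri2 G"
    using gamma_ri2_attained[OF assms] .
  then show ?thesis
    by (metis assms card_mono coloured_subset pair_graph_finite_verts weight_eq_card_coloured)
qed

definition path3 :: "nat pair_pre_digraph" where
  "path3 = \<lparr> pverts = {0, 1, 2}, parcs = {(0, 1), (1, 0), (1, 2), (2, 1)} \<rparr>"

lemma gamma_ri2_path3_sum:
  "pair_graph path3 \<and> card (pverts path3) \<ge> 3 \<and>
   gamma_ri2 path3 + gamma_ri2 (graph_complement path3) = 5"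
proof -
  have G: "pair_graph path3"
    by (rule pair_graphI) (auto simp: path3_def sym_def irrefl_def)
  have n: "card (pverts path3) = 3" by (simp add: path3_def)
  \<comment> \<open>The two ends get different colours, and the middle vertex sees both.\<close>
  define f :: "nat \<Rightarrow> nat" where "f = (\<lambda>_. 0)(0 := 1, 2 := 2)"
  have c: "colour_class path3 f 1 = {0}" "colour_class path3 f 2 = {2}"
    "colour_class path3 f 0 = {1}"
    by (auto simp: colour_class_def path3_def f_def)
  have "two_rainbow_indep_dom path3 f"
    unfolding two_rainbow_indep_dom_def c
    by (auto simp: independent_in_def path3_def f_def)
  then have "gamma_ri2 path3 \<le> weight path3 f" by (rule gamma_ri2_le)
  also have "weight path3 f = 2" unfolding weight_def c by simp
  finally have "gamma_ri2 path3 \<le> 2" .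
  \<comment> \<open>The trivial bound is enough here, since the general lower bound then forces the
    sum to be 5.\<close>
  moreover have "gamma_ri2 (graph_complement path3) \<le> 3"
    using gamma_ri2_le_card[OF pair_graph_complement[OF G]] n by simp
  moreover have "5 \<le> gamma_ri2 path3 + gamma_ri2 (graph_complement path3)"
    using gamma_ri2_sum_lower[OF G] n by simp
  ultimately show ?thesis using G n by auto
qed

section \<open>Sharpness of the upper bound: the 5-cycle\<close>

text \<open>The cyclic order is kept as explicit arguments, so that rotations and the complement
  fall under one argument.\<close>

definition is_cycle5 :: "'a pair_pre_digraph \<Rightarrow> 'a \<Rightarrow> 'a \<Rightarrow> 'a \<Rightarrow> 'a \<Rightarrow> 'a \<Rightarrow> bool" where
  "is_cycle5 G a b c d e \<longleftrightarrow> pair_graph G \<and> distinct [a, b, c, d, e] \<and> pverts G = {a, b, c, d, e} \<and>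
     nbrs G a = {b, e} \<and> nbrs G b = {a, c} \<and> nbrs G c = {b, d} \<and> nbrs G d = {c, e} \<and>
     nbrs G e = {a, d}"

lemma is_cycle5_rotate: "is_cycle5 G a b c d e \<Longrightarrow> is_cycle5 G b c d e a"
  unfolding is_cycle5_def by auto

lemma rainbow_uncoloured_two_nbrs:
  assumes "two_rainbow_indep_dom G f" "v \<in> pverts G" "f v = 0" "nbrs G v = {y, z}"
  shows "f y = 1 \<and> f z = 2 \<or> f y = 2 \<and> f z = 1"
proof -
  have "v \<notin> coloured G f"
    using assms(3) by (simp add: coloured_def colour_class_def)
  then obtain p q where pq: "p \<in> colour_class G f 1" "(v, p) \<in> parcs G"
    "q \<in> colour_class G f 2" "(v, q) \<in> parcs G"
    using uncoloured[OF assms(1,2)] by blast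
  then have "p \<in> {y, z}" "q \<in> {y, z}" "f p = 1" "f q = 2"
    by (auto simp: colour_class_def simp flip: assms(4)) (auto simp: nbrs_def)
  then show ?thesis by auto
qed

lemma rainbow_proper:
  assumes G: "pair_graph G" and f: "two_rainbow_indep_dom G f" and "w \<in> nbrs G v" "f v \<noteq> 0"
  shows "f w \<noteq> f v"
proof
  assume eq: "f w = f v"
  have arc: "(v, w) \<in> parcs G" using assms(3) by (simp add: nbrs_def)
  note V = pair_graph_arc_in_verts[OF G arc]
  have "f v \<in> {0, 1, 2}"
    using f V(1) unfolding two_rainbow_indep_dom_def by blast
  then obtain i where i: "i \<in> {1, 2}" "f v = i" using assms(4) by blast
  have "v \<in> colour_class G f i" "w \<in> colour_class G f i"
    using V i(2) eq by (auto simp: colour_class_def)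
  then show False
    using f arc i(1) unfolding two_rainbow_indep_dom_def independent_in_def by blast
qed

text \<open>With \<open>a\<close> uncoloured, \<open>b\<close> and \<open>e\<close> have different
  nonzero colours. If \<open>c\<close> were uncoloured too, then \<open>d\<close> would differ from
  \<open>b\<close> and so repeat the colour of its neighbour \<open>e\<close>; symmetrically for
  \<open>d\<close>.\<close>

lemma rainbow_cycle5_uncoloured:
  assumes C: "is_cycle5 G a b c d e" and f: "two_rainbow_indep_dom G f"
    and a: "f a = 0" and x: "x \<in> pverts G" "f x = 0"
  shows "x = a"
proof -
  have G: "pair_graph G" and V: "pverts G = {a, b, c, d, e}"
    and N: "nbrs G a = {b, e}" "nbrs G c = {b, d}" "nbrs G d = {c, e}" "c \<in> nbrs G b" "e \<in> nbrs G d"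
    using C unfolding is_cycle5_def by auto
  have be: "f b = 1 \<and> f e = 2 \<or> f b = 2 \<and> f e = 1"
    using rainbow_uncoloured_two_nbrs[OF f _ a N(1)] V by simp
  have bc: "f b \<noteq> 0 \<Longrightarrow> f c \<noteq> f b" and de: "f d \<noteq> 0 \<Longrightarrow> f e \<noteq> f d"
    using rainbow_proper[OF G f] N(4,5) by auto
  have "f c \<noteq> 0"
  proof
    assume "f c = 0"
    then have "f b = 1 \<and> f d = 2 \<or> f b = 2 \<and> f d = 1"
      using rainbow_uncoloured_two_nbrs[OF f _ _ N(2)] V by simp
    with be de show False by (elim disjE) simp_all
  qed
  moreover have "f d \<noteq> 0"
  proof
    assume "f d = 0"
    then have "f c = 1 \<and> f e = 2 \<or> f c = 2 \<and> f e = 1"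
      using rainbow_uncoloured_two_nbrs[OF f _ _ N(3)] V by simp
    with be bc show False by (elim disjE) simp_all
  qed
  ultimately show ?thesis
    using x be V by auto
qed

text \<open>At most one of the five vertices is uncoloured.\<close>

lemma gamma_ri2_cycle5_ge:
  assumes C: "is_cycle5 G a b c d e"
  shows "4 \<le> gamma_ri2 G"
proof -
  have G: "pair_graph G" and V: "pverts G = {a, b, c, d, e}" and n: "card (pverts G) = 5"
    using C unfolding is_cycle5_def by auto
  \<comment> \<open>The rotations let each vertex play the role of \<open>a\<close>.\<close>
  note C2 = is_cycle5_rotate[OF C]
  note C3 = is_cycle5_rotate[OF C2]
  note C4 = is_cycle5_rotate[OF C3]
  note C5 = is_cycle5_rotate[OF C4]
  show ?thesis
  proof (rule gamma_ri2_ge[OF G])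
    fix f assume f: "two_rainbow_indep_dom G f"
    let ?Z = "colour_class G f 0"
    have "x = y" if "x \<in> ?Z" "y \<in> ?Z" for x y
    proof -
      have xy: "x \<in> pverts G" "y \<in> pverts G" "f x = 0" "f y = 0"
        using that by (auto simp: colour_class_def)
      then have "x = a \<or> x = b \<or> x = c \<or> x = d \<or> x = e" using V by simp
      then show ?thesis
        using xy(2-4) C C2 C3 C4 C5 rainbow_cycle5_uncoloured[OF _ f] by metis
    qed
    then have "card ?Z \<le> 1"
      using finite_colour_class[OF G] by (simp add: card_le_Suc0_iff_eq)
    moreover have "coloured G f = pverts G - ?Z"
      using f unfolding two_rainbow_indep_dom_def coloured_def colour_class_def
      by (auto simp: Pi_iff)
    moreover have "card (pverts G - ?Z) = card (pverts G) - card ?Z"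
      by (rule card_Diff_subset[OF finite_colour_class[OF G] colour_class_subset])
    ultimately show "4 \<le> weight G f"
      by (simp add: weight_eq_card_coloured[OF G] n)
  qed
qed

definition cycle5 :: "nat pair_pre_digraph" where
  "cycle5 = \<lparr> pverts = {0, 1, 2, 3, 4},
     parcs = {(0, 1), (1, 2), (2, 3), (3, 4), (4, 0), (1, 0), (2, 1), (3, 2), (4, 3), (0, 4)} \<rparr>"

lemma is_cycle5_cycle5: "is_cycle5 cycle5 0 1 2 3 4"
proof -
  have "pair_graph cycle5"
    by (rule pair_graphI) (auto simp: cycle5_def sym_def irrefl_def)
  then show ?thesis
    by (auto simp: is_cycle5_def nbrs_def cycle5_def)
qed

text \<open>Distinct non-adjacent vertices of \<open>cycle5\<close> differ by 2 modulo 5, so steps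
  of two trace out the complement.\<close>

lemma is_cycle5_complement_cycle5: "is_cycle5 (graph_complement cycle5) 0 2 4 1 3"
proof -
  have "pair_graph (graph_complement cycle5)"
    using is_cycle5_cycle5 by (simp add: is_cycle5_def pair_graph_complement)
  then show ?thesis
    by (auto simp: is_cycle5_def nbrs_def parcs_complement) (auto simp: cycle5_def)
qed

lemma gamma_ri2_cycle5_sum:
  "pair_graph cycle5 \<and> card (pverts cycle5) \<ge> 3 \<and>
   gamma_ri2 cycle5 + gamma_ri2 (graph_complement cycle5) = card (pverts cycle5) + 3"
proof -
  have G: "pair_graph cycle5" using is_cycle5_cycle5 by (simp add: is_cycle5_def)
  have n: "card (pverts cycle5) = 5" by (simp add: cycle5_def)
  have "4 \<le> gamma_ri2 cycle5" "4 \<le> gamma_ri2 (graph_complement cycle5)"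
    by (rule gamma_ri2_cycle5_ge, rule is_cycle5_cycle5)
      (rule gamma_ri2_cycle5_ge, rule is_cycle5_complement_cycle5)
  \<comment> \<open>The two lower bounds give 4 + 4 = 5 + 3, which the general upper bound
    meets.\<close>
  moreover have "gamma_ri2 cycle5 + gamma_ri2 (graph_complement cycle5) \<le> card (pverts cycle5) + 3"
    using n by (intro gamma_ri2_sum_upper[OF G]) auto
  ultimately show ?thesis using G n by linarith
qed

theorem theorem4p3:
  shows "(\<forall>G :: 'a pair_pre_digraph. pair_graph G \<and> card (pverts G) \<ge> 3 \<longrightarrow>
            5 \<le> gamma_ri2 G + gamma_ri2 (graph_complement G) \<and>
            gamma_ri2 G + gamma_ri2 (graph_complement G) \<le> card (pverts G) + 3)
       \<and> (\<exists>G :: nat pair_pre_digraph. pair_graph G \<and> card (pverts G) \<ge> 3 \<and>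
            gamma_ri2 G + gamma_ri2 (graph_complement G) = 5)
       \<and> (\<exists>G :: nat pair_pre_digraph. pair_graph G \<and> card (pverts G) \<ge> 3 \<and>
            gamma_ri2 G + gamma_ri2 (graph_complement G) = card (pverts G) + 3)"
proof (intro conjI allI impI)
  fix G :: "'a pair_pre_digraph"
  assume G: "pair_graph G \<and> card (pverts G) \<ge> 3"
  then show "5 \<le> gamma_ri2 G + gamma_ri2 (graph_complement G)"
    by (intro gamma_ri2_sum_lower) auto
  from G show "gamma_ri2 G + gamma_ri2 (graph_complement G) \<le> card (pverts G) + 3"
    by (intro gamma_ri2_sum_upper) auto
next
  show "\<exists>G :: nat pair_pre_digraph. pair_graph G \<and> card (pverts G) \<ge> 3 \<and>
      gamma_ri2 G + gamma_ri2 (graph_complement G) = 5"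
    using gamma_ri2_path3_sum by blast
next
  show "\<exists>G :: nat pair_pre_digraph. pair_graph G \<and> card (pverts G) \<ge> 3 \<and>
      gamma_ri2 G + gamma_ri2 (graph_complement G) = card (pverts G) + 3"
    using gamma_ri2_cycle5_sum by blast
qed

end
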